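(* Let $P'=\{x\in\mathbb{R}^n:\bar Ax\le\bar b\}$ be a simplicial cone, where $\bar A\in\mathbb{R}^{n\times n}$ is invertible and $\bar b\in\mathbb{R}^n$, with apex $\bar x=\bar A^{-1}\bar b$. Let $S\subset\mathbb{R}^n$ be a closed set and let $C\subset\mathbb{R}^n$ be a closed $S$-free set with $\bar x\in\mathrm{int}(C)$. Let $r^1,\dots,r^n$, the step lengths $\lambda^*_j\in(0,\infty]$, the index sets $M$ and $\bar M$, and $y^*=(y^*_j)_{j\in\bar M}$ be as defined in the context, and assume $M\neq\emptyset$. For $y=(y_j)_{j\in\bar M}$ with each $y_j\in[-\infty,0)$, let $V_y$ be the halfspace $$V_y:=\Bigl\{x\in\mathbb{R}^n:\ \sum_{m\in M} (\bar a_{m,*}x-\bar b_m)/\lambda_m^* +\sum_{j \in \bar M} (\bar a_{j,*}x-\bar b_j)/y_j \leq - 1\Bigr\}.$$ Then $V_y \cap P' \supseteq P'\setminus \mathrm{int}(C)$ if and only if $y \leq y^*$ (componentwise).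
   Context: A set $C\subset\mathbb{R}^n$ is $S$-free if $C$ is convex and $\mathrm{int}(C)\cap S=\emptyset$. $\mathrm{rec}(C)$ denotes the recession cone of $C$, $\mathrm{bd}(C)$ its boundary, $\mathrm{int}(C)$ its interior. $\bar a_{i,*}$ denotes the $i$th row of $\bar A$. Rays: $-r^j$ is the $j$th column of $\bar A^{-1}$, so $P'=\{\bar x+\sum_{j=1}^n\lambda_jr^j:\lambda\ge 0\}$. Step lengths: for each $j$, either $\bar x+\lambda_jr^j\in\mathrm{int}(C)$ for all $\lambda_j\ge 0$, in which case $\lambda^*_j:=\infty$; or else $\lambda_j^*\in(0,\infty)$ is the finite value such that $\bar x+\lambda^*_jr^j\in\mathrm{bd}(C)$. $M$ is the set of indices $j$ with $\lambda^*_j<\infty$, and $\bar M=\{1,\dots,n\}\setminus M$. For $j\in\bar M$, $$y^*_j := \max \{\gamma\in\mathbb{R} : \lambda^*_mr^{m} - \gamma r^{j} \in \mathrm{rec}(C)\ \ \forall m \in M\},$$ with $y^*_j:=-\infty$ if no such $\gamma$ exists. (One has $y^*_j<0$.) Convention: $1/(-\infty)=0$. *)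

theory Defs
  imports "HOL-Analysis.Analysis"
begin

definition S_free :: "(real^'n) set \<Rightarrow> (real^'n) set \<Rightarrow> bool" where
  "S_free S C \<longleftrightarrow> convex C \<and> interior C \<inter> S = {}"

definition recession_cone :: "(real^'n) set \<Rightarrow> (real^'n) set" where
  "recession_cone C = {d. \<forall>x\<in>C. \<forall>t\<ge>0. x + t *\<^sub>R d \<in> C}"

definition simplicial_cone :: "real^'n^'n \<Rightarrow> real^'n \<Rightarrow> (real^'n) set" where
  "simplicial_cone A b = {x. \<forall>i. (A *v x) $ i \<le> b $ i}"

definition apex :: "real^'n^'n \<Rightarrow> real^'n \<Rightarrow> real^'n" where
  "apex A b = matrix_inv A *v b"

definition ray :: "real^'n^'n \<Rightarrow> 'n \<Rightarrow> real^'n" where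
  "ray A j = - column j (matrix_inv A)"

(* When C is closed and convex with the apex in its interior, the value in the
   second case exists and is unique. *)
definition step_length :: "real^'n^'n \<Rightarrow> real^'n \<Rightarrow> (real^'n) set \<Rightarrow> 'n \<Rightarrow> ereal" where
  "step_length A b C j =
    (if \<forall>t\<ge>0. apex A b + t *\<^sub>R ray A j \<in> interior C then \<infinity>
     else ereal (THE t. t > 0 \<and> apex A b + t *\<^sub>R ray A j \<in> frontier C))"

definition finite_steps :: "real^'n^'n \<Rightarrow> real^'n \<Rightarrow> (real^'n) set \<Rightarrow> 'n set" where
  "finite_steps A b C = {j. step_length A b C j < \<infinity>}"

definition admissible :: "real^'n^'n \<Rightarrow> real^'n \<Rightarrow> (real^'n) set \<Rightarrow> 'n \<Rightarrow> real \<Rightarrow> bool" where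
  "admissible A b C j \<gamma> \<longleftrightarrow>
    (\<forall>m\<in>finite_steps A b C.
      real_of_ereal (step_length A b C m) *\<^sub>R ray A m - \<gamma> *\<^sub>R ray A j \<in> recession_cone C)"

(* When C is closed and convex with the apex in its interior, finite_steps A b C is
   nonempty and j is not in it, the admissible values form a closed set of negative
   reals, so the maximum is attained as soon as some value is admissible. *)
definition y_star :: "real^'n^'n \<Rightarrow> real^'n \<Rightarrow> (real^'n) set \<Rightarrow> 'n \<Rightarrow> ereal" where
  "y_star A b C j =
    (if \<exists>\<gamma>. admissible A b C j \<gamma> then ereal (GREATEST \<gamma>. admissible A b C j \<gamma>) else -\<infinity>)"

(* Division is that of ereal, where x / (-\<infinity>) = 0 for every real x. Only the values
   y j with j outside finite_steps A b C are used. *)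
definition cut_halfspace ::
  "real^'n^'n \<Rightarrow> real^'n \<Rightarrow> (real^'n) set \<Rightarrow> ('n \<Rightarrow> ereal) \<Rightarrow> (real^'n) set" where
  "cut_halfspace A b C y =
    {x. (\<Sum>m\<in>finite_steps A b C. ereal (row m A \<bullet> x - b $ m) / step_length A b C m)
      + (\<Sum>j\<in>- finite_steps A b C. ereal (row j A \<bullet> x - b $ j) / y j) \<le> - 1}"

end

theory Submission
  imports Defs
begin

text \<open>
  Write a point of the cone as \<open>x = apex + (\<Sum>i. l i *\<^sub>R r i)\<close> with slacks
  \<open>l i = b $ i - (A *v x) $ i \<ge> 0\<close>, and put \<open>p m = L m *\<^sub>R r m\<close> for the vector from the apex to
  the boundary point on a ray of finite step length \<open>L m\<close>. In these coordinates the cut reads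
  \<open>(\<Sum>m\<in>M. l m / L m) + (\<Sum>j\<in>-M. l j / y j) \<ge> 1\<close>, where the second sum has nonpositive terms.

  If \<open>y \<le> y_star\<close>, then each finite \<open>y j\<close> is admissible, so \<open>p m - y j *\<^sub>R r j\<close> is a recession
  direction of \<open>C\<close> for every \<open>m\<close>. A point of the cone violating the cut has weights
  \<open>l m / L m\<close> on the \<open>p m\<close> and \<open>l j / - y j\<close> on the \<open>- y j *\<^sub>R r j\<close> whose totals differ by less
  than \<open>1\<close>. Pairing weight of the first kind with weight of the second kind yields recession
  directions; what is left over is either a subconvex combination of the \<open>p m\<close> with total weight
  below \<open>1\<close>, which leads from the apex to an interior point, or again a recession direction.
  So the point lies in the interior of \<open>C\<close> (lemma \<open>cut_shortfall_interior\<close>).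

  Conversely, if \<open>y j > y_star j\<close> for some \<open>j\<close>, then \<open>y j\<close> is finite and not admissible, so some
  \<open>d = p m - y j *\<^sub>R r j\<close> is not a recession direction and the half-line from the apex along \<open>d\<close>
  leaves \<open>C\<close>. It stays in the cone, and on it the two sums of the cut cancel, so the point where it
  is outside \<open>C\<close> violates the cut.

  That admissibility of a real number is the same as lying below \<open>y_star\<close> is lemma
  \<open>le_y_star_iff_admissible\<close>: the admissible values are closed and closed downwards, and they are
  negative because no \<open>p m\<close> is a recession direction.
\<close>

section \<open>Recession cones\<close>

lemma recession_coneD: "d \<in> recession_cone C \<Longrightarrow> x \<in> C \<Longrightarrow> x + d \<in> C"
  unfolding recession_cone_def by (metis (mono_tags, lifting) mem_Collect_eq scaleR_one zero_le_one)

lemma zero_in_recession_cone: "0 \<in> recession_cone C"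
  by (simp add: recession_cone_def)

lemma recession_cone_scale:
  assumes "d \<in> recession_cone C" "c \<ge> 0"
  shows "c *\<^sub>R d \<in> recession_cone C"
  using assms by (simp add: recession_cone_def)

lemma recession_cone_add:
  assumes "d \<in> recession_cone C" "e \<in> recession_cone C"
  shows "d + e \<in> recession_cone C"
  using assms by (simp add: recession_cone_def scaleR_add_right flip: add.assoc)

lemma recession_cone_sum:
  assumes "\<And>i. i \<in> I \<Longrightarrow> f i \<in> recession_cone C"
  shows "sum f I \<in> recession_cone C"
  using assms
  by (induction I rule: infinite_finite_induct)
    (auto intro: recession_cone_add zero_in_recession_cone)

lemma interior_plus_recession:
  assumes "x \<in> interior C" "d \<in> recession_cone C"
  shows "x + d \<in> interior C"
proof -
  have "(+) d ` interior C \<subseteq> C"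
    using assms(2) recession_coneD interior_subset by (fastforce simp: add.commute)
  then have "(+) d ` interior C \<subseteq> interior C"
    by (simp add: interior_maximal open_translation)
  then show ?thesis
    using assms(1) by (auto simp: add.commute)
qed

lemma closed_recession_cone:
  assumes "closed C"
  shows "closed (recession_cone C)"
proof -
  have "closed ((\<lambda>d. x + t *\<^sub>R d) -` C)" for x and t :: real
    by (intro closed_vimage assms continuous_intros)
  moreover have "recession_cone C = (\<Inter>x\<in>C. \<Inter>t\<in>{0..}. (\<lambda>d. x + t *\<^sub>R d) -` C)"
    by (auto simp: recession_cone_def)
  ultimately show ?thesis
    by auto
qed

text \<open>
  A half-line in a closed convex set can be moved to any other base point \<open>x\<close>: the segments from \<open>x\<close>
  to far points of the given half-line converge to the half-line from \<open>x\<close>.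
\<close>
lemma recession_cone_from_point:
  assumes "closed C" "convex C" and ray: "\<And>t. t \<ge> 0 \<Longrightarrow> c + t *\<^sub>R d \<in> C"
  shows "d \<in> recession_cone C"
  unfolding recession_cone_def
proof (intro CollectI ballI allI impI)
  fix x and t :: real
  assume "x \<in> C" "t \<ge> 0"
  define e where "e n = inverse (real (Suc n))" for n
  define f where "f n = (1 - e n) *\<^sub>R x + e n *\<^sub>R c + t *\<^sub>R d" for n
  have e0: "e \<longlonglongrightarrow> 0"
    unfolding e_def by (rule LIMSEQ_inverse_real_of_nat)
  have "f \<longlonglongrightarrow> (1 - 0) *\<^sub>R x + 0 *\<^sub>R c + t *\<^sub>R d"
    unfolding f_def by (intro tendsto_intros e0)
  moreover have "f n \<in> C" for n
  proof -
    have e: "0 < e n" "e n \<le> 1"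
      by (auto simp: e_def field_simps)
    have "(1 - e n) *\<^sub>R x + e n *\<^sub>R (c + (t / e n) *\<^sub>R d) \<in> C"
      using e \<open>x \<in> C\<close> \<open>t \<ge> 0\<close> by (intro convexD[OF assms(2)] ray) auto
    then show ?thesis
      using e by (simp add: f_def scaleR_add_right add.assoc)
  qed
  ultimately show "x + t *\<^sub>R d \<in> C"
    using closed_sequentially[OF assms(1)] by force
qed

section \<open>Points that violate the cut are interior\<close>

lemma subconvex_combination_interior:
  fixes C :: "'a::euclidean_space set"
  assumes "convex C" "c \<in> interior C" "finite M"
    and p: "\<And>m. m \<in> M \<Longrightarrow> c + p m \<in> C"
    and k: "\<And>m. m \<in> M \<Longrightarrow> k m \<ge> 0" and lt: "sum k M < 1"
  shows "c + (\<Sum>m\<in>M. k m *\<^sub>R p m) \<in> interior C"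
proof (cases "sum k M = 0")
  case True
  then have "\<forall>m\<in>M. k m = 0"
    using k assms(3) by (simp add: sum_nonneg_eq_0_iff)
  then show ?thesis
    using assms(2) by simp
next
  case False
  define s where "s = sum k M"
  have s: "0 < s" "s < 1"
    using False k lt by (auto simp: s_def less_le sum_nonneg)
  define z where "z = (\<Sum>m\<in>M. (k m / s) *\<^sub>R (c + p m))"
  have sum1: "(\<Sum>m\<in>M. k m / s) = 1"
    using s by (simp add: s_def flip: sum_divide_distrib)
  have "z \<in> C"
    unfolding z_def using s k p sum1
    by (intro convex_sum assms) auto
  have z: "z = c + (1 / s) *\<^sub>R (\<Sum>m\<in>M. k m *\<^sub>R p m)"
    unfolding z_def
    by (simp add: scaleR_add_right sum.distrib sum1 scaleR_sum_right flip: scaleR_sum_left)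
  have "z - (1 - s) *\<^sub>R (z - c) \<in> interior C"
    using s \<open>z \<in> C\<close> by (intro mem_interior_convex_shrink assms) auto
  moreover have "z - (1 - s) *\<^sub>R (z - c) = c + s *\<^sub>R (z - c)"
    by (simp add: algebra_simps)
  moreover have "s *\<^sub>R (z - c) = (\<Sum>m\<in>M. k m *\<^sub>R p m)"
    using s by (simp add: z)
  ultimately show ?thesis
    by simp
qed

text \<open>
  Multiplying out, \<open>(\<Sum>j\<in>J. v j) *\<^sub>R (\<Sum>m\<in>M. u m *\<^sub>R p m) + (\<Sum>m\<in>M. u m) *\<^sub>R (\<Sum>j\<in>J. v j *\<^sub>R e j)\<close> is a
  nonnegative combination of the recession directions \<open>p m + e j\<close>. Scaled so that it uses up the
  smaller of the two total weights, it absorbs one kind of direction completely. What is left is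
  a nonnegative combination of the \<open>p m\<close> of total weight below \<open>1\<close>, or a nonnegative multiple of
  \<open>\<Sum>j\<in>J. v j *\<^sub>R e j\<close>.
\<close>
lemma cut_shortfall_interior:
  assumes "convex C" "c \<in> interior C" "finite M"
    and p: "\<And>m. m \<in> M \<Longrightarrow> c + p m \<in> C"
    and e: "\<And>j. j \<in> J \<Longrightarrow> e j \<in> recession_cone C"
    and pe: "\<And>m j. m \<in> M \<Longrightarrow> j \<in> J \<Longrightarrow> p m + e j \<in> recession_cone C"
    and u: "\<And>m. m \<in> M \<Longrightarrow> u m \<ge> 0" and v: "\<And>j. j \<in> J \<Longrightarrow> v j \<ge> 0"
    and lt: "sum u M - sum v J < 1"
  shows "c + (\<Sum>m\<in>M. u m *\<^sub>R p m) + (\<Sum>j\<in>J. v j *\<^sub>R e j) \<in> interior C"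
proof -
  define s N where "s = sum u M" and "N = sum v J"
  define q E where "q = (\<Sum>m\<in>M. u m *\<^sub>R p m)" and "E = (\<Sum>j\<in>J. v j *\<^sub>R e j)"
  have s: "s \<ge> 0" and N: "N \<ge> 0"
    using u v by (auto simp: s_def N_def intro: sum_nonneg)
  have E: "E \<in> recession_cone C"
    unfolding E_def by (intro recession_cone_sum recession_cone_scale e v)
  have "(\<Sum>j\<in>J. \<Sum>m\<in>M. (v j * u m) *\<^sub>R (p m + e j)) \<in> recession_cone C"
    by (intro recession_cone_sum recession_cone_scale pe mult_nonneg_nonneg u v)
  moreover have "(\<Sum>j\<in>J. \<Sum>m\<in>M. (v j * u m) *\<^sub>R (p m + e j)) = N *\<^sub>R q + s *\<^sub>R E"
  proof -
    have "(\<Sum>m\<in>M. (v j * u m) *\<^sub>R (p m + e j)) = v j *\<^sub>R q + s *\<^sub>R (v j *\<^sub>R e j)" for j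
      by (simp add: q_def s_def scaleR_add_right sum.distrib scaleR_sum_right scaleR_sum_left
          mult.commute sum_distrib_right sum_distrib_left)
    then have "(\<Sum>j\<in>J. \<Sum>m\<in>M. (v j * u m) *\<^sub>R (p m + e j))
        = (\<Sum>j\<in>J. v j *\<^sub>R q) + (\<Sum>j\<in>J. s *\<^sub>R (v j *\<^sub>R e j))"
      by (simp only: sum.distrib)
    then show ?thesis
      by (simp only: N_def E_def scaleR_sum_left scaleR_sum_right)
  qed
  ultimately have h: "N *\<^sub>R q + s *\<^sub>R E \<in> recession_cone C"
    by simp
  consider "N < s" | "s = 0" | "s \<le> N" "s > 0"
    using s by linarith
  then have "c + q + E \<in> interior C"
  proof cases
    case 1
    then have "s > 0"
      using N by simp
    have "c + (\<Sum>m\<in>M. ((1 - N / s) * u m) *\<^sub>R p m) \<in> interior C"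
    proof (rule subconvex_combination_interior[OF assms(1-3) p])
      show "(1 - N / s) * u m \<ge> 0" if "m \<in> M" for m
        using u[OF that] 1 \<open>s > 0\<close> by simp
      have "(\<Sum>m\<in>M. (1 - N / s) * u m) = (1 - N / s) * s"
        by (simp add: s_def flip: sum_distrib_left)
      also have "\<dots> = s - N"
        using \<open>s > 0\<close> by (simp add: algebra_simps)
      finally show "(\<Sum>m\<in>M. (1 - N / s) * u m) < 1"
        using lt by (simp add: s_def N_def)
    qed
    then have "c + (1 - N / s) *\<^sub>R q \<in> interior C"
      by (simp add: q_def scaleR_sum_right)
    then have "c + (1 - N / s) *\<^sub>R q + (1 / s) *\<^sub>R (N *\<^sub>R q + s *\<^sub>R E) \<in> interior C"
      by (rule interior_plus_recession) (use s in \<open>auto intro: recession_cone_scale[OF h]\<close>)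
    moreover have "(1 / s) *\<^sub>R (N *\<^sub>R q + s *\<^sub>R E) = (N / s) *\<^sub>R q + E"
      using \<open>s > 0\<close> by (simp add: scaleR_add_right)
    ultimately show ?thesis
      by (simp add: scaleR_diff_left add.assoc)
  next
    case 2
    then have "\<forall>m\<in>M. u m = 0"
      using u assms(3) by (simp add: s_def sum_nonneg_eq_0_iff)
    then have "q = 0"
      by (simp add: q_def)
    then show ?thesis
      using interior_plus_recession[OF assms(2) E] by simp
  next
    case 3
    have "c + ((1 / N) *\<^sub>R (N *\<^sub>R q + s *\<^sub>R E) + (1 - s / N) *\<^sub>R E) \<in> interior C"
    proof (intro interior_plus_recession[OF assms(2)] recession_cone_add)
      show "(1 / N) *\<^sub>R (N *\<^sub>R q + s *\<^sub>R E) \<in> recession_cone C"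
        using N by (intro recession_cone_scale h) simp
      show "(1 - s / N) *\<^sub>R E \<in> recession_cone C"
        using 3 by (intro recession_cone_scale E) simp
    qed
    moreover have "(1 / N) *\<^sub>R (N *\<^sub>R q + s *\<^sub>R E) = q + (s / N) *\<^sub>R E"
      using 3 by (simp add: scaleR_add_right)
    ultimately show ?thesis
      by (simp add: scaleR_diff_left add.assoc)
  qed
  then show ?thesis
    by (simp add: q_def E_def)
qed

section \<open>Slack coordinates on the simplicial cone\<close>

lemma matrix_mult_matrix_inv:
  assumes "invertible A"
  shows "A ** matrix_inv A = mat 1" "matrix_inv A ** A = mat 1"
  using someI_ex[OF assms[unfolded invertible_def]] by (simp_all add: matrix_inv_def)

lemma ray_eq: "ray A j = - (matrix_inv A *v axis j 1)"
  by (simp add: ray_def matrix_vector_mult_basis)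

lemma matrix_vector_ray:
  assumes "invertible A"
  shows "A *v ray A j = - axis j 1"
  using assms
  by (simp add: ray_eq linear_neg[OF matrix_vector_mul_linear] matrix_vector_mul_assoc
      matrix_mult_matrix_inv)

lemma matrix_vector_apex:
  assumes "invertible A"
  shows "A *v apex A b = b"
  using assms by (simp add: apex_def matrix_vector_mul_assoc matrix_mult_matrix_inv)

lemma apex_ray_expansion:
  assumes "invertible A"
  shows "x = apex A b + (\<Sum>i\<in>UNIV. (b $ i - (A *v x) $ i) *\<^sub>R ray A i)"
proof -
  have "matrix_inv A *v (b - A *v x)
      = matrix_inv A *v (\<Sum>i\<in>UNIV. (b $ i - (A *v x) $ i) *\<^sub>R axis i 1)"
    using basis_expansion[of "b - A *v x"] by (simp add: scalar_mult_eq_scaleR)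
  also have "\<dots> = - (\<Sum>i\<in>UNIV. (b $ i - (A *v x) $ i) *\<^sub>R ray A i)"
    by (simp only: ray_eq linear_sum[OF matrix_vector_mul_linear] matrix_vector_mult_scaleR
        scaleR_minus_right sum_negf minus_minus)
  moreover have "matrix_inv A *v (b - A *v x) = apex A b - x"
    using assms
    by (simp add: apex_def matrix_vector_mult_diff_distrib matrix_vector_mul_assoc
        matrix_mult_matrix_inv)
  ultimately show ?thesis
    by (simp add: algebra_simps)
qed

text \<open>
  With \<open>real_of_ereal (-\<infinity>) = 0\<close> and \<open>z / 0 = 0\<close> on the reals, the convention \<open>z / (-\<infinity>) = 0\<close> carries
  over, so the cut can be written with real numbers throughout.
\<close>
lemma ereal_divide_real:
  assumes "w \<noteq> 0"
  shows "ereal z / w = ereal (z / real_of_ereal w)"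
  using assms by (cases w) auto

lemma cut_halfspace_iff:
  assumes "\<And>m. m \<in> finite_steps A b C \<Longrightarrow> step_length A b C m \<noteq> 0"
    and "\<And>j. j \<notin> finite_steps A b C \<Longrightarrow> y j \<noteq> 0"
  shows "x \<in> cut_halfspace A b C y \<longleftrightarrow>
    (\<Sum>m\<in>finite_steps A b C. (b $ m - (A *v x) $ m) / real_of_ereal (step_length A b C m))
    + (\<Sum>j\<in>- finite_steps A b C. (b $ j - (A *v x) $ j) / real_of_ereal (y j)) \<ge> 1"
proof -
  have row: "row i A \<bullet> x - b $ i = - (b $ i - (A *v x) $ i)" for i
    by (simp add: matrix_vector_mul_component row_def inner_vec_def)
  have "(\<Sum>m\<in>finite_steps A b C. ereal (row m A \<bullet> x - b $ m) / step_length A b C m)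
      = (\<Sum>m\<in>finite_steps A b C.
          ereal (- ((b $ m - (A *v x) $ m) / real_of_ereal (step_length A b C m))))"
    using assms(1) by (intro sum.cong refl) (simp only: row ereal_divide_real[OF assms(1)] minus_divide_left)
  moreover have "(\<Sum>j\<in>- finite_steps A b C. ereal (row j A \<bullet> x - b $ j) / y j)
      = (\<Sum>j\<in>- finite_steps A b C. ereal (- ((b $ j - (A *v x) $ j) / real_of_ereal (y j))))"
    by (intro sum.cong refl) (simp add: row ereal_divide_real[OF assms(2)] del: minus_diff_eq)
  ultimately have "x \<in> cut_halfspace A b C y \<longleftrightarrow>
      ereal (- (\<Sum>m\<in>finite_steps A b C. (b $ m - (A *v x) $ m) / real_of_ereal (step_length A b C m))
    - (\<Sum>j\<in>- finite_steps A b C. (b $ j - (A *v x) $ j) / real_of_ereal (y j))) \<le> ereal (- 1)"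
    unfolding cut_halfspace_def
    by (simp only: mem_Collect_eq sum_ereal sum_negf plus_ereal.simps one_ereal_def
        uminus_ereal.simps diff_conv_add_uminus)
  then show ?thesis
    unfolding ereal_less_eq by linarith
qed

section \<open>Step lengths and the bound \<open>y_star\<close>\<close>

text \<open>
  A ray that leaves the interior of \<open>C\<close> crosses the frontier by connectedness, and only once: points
  strictly between the apex and a point of the closure are interior.
\<close>
lemma step_length_finite:
  assumes "convex C" "apex A b \<in> interior C" "m \<in> finite_steps A b C"
  obtains t where "step_length A b C m = ereal t" "t > 0"
    "apex A b + t *\<^sub>R ray A m \<in> frontier C"
proof -
  define c r where "c = apex A b" and "r = ray A m"
  have c: "c \<in> interior C"
    using assms(2) by (simp add: c_def)
  have leaves: "\<not> (\<forall>t\<ge>0. c + t *\<^sub>R r \<in> interior C)"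
    using assms(3) by (auto simp: finite_steps_def step_length_def c_def r_def split: if_splits)
  then obtain T where T: "T \<ge> 0" "c + T *\<^sub>R r \<notin> interior C"
    by blast
  define g where "g t = c + t *\<^sub>R r" for t
  have "connected (g ` {0..T})"
    unfolding g_def by (intro connected_continuous_image continuous_intros) auto
  moreover have "g 0 \<in> g ` {0..T} \<inter> interior C" "g T \<in> g ` {0..T} - interior C"
    using T c by (auto simp: g_def)
  ultimately have "g ` {0..T} \<inter> frontier (interior C) \<noteq> {}"
    by (intro connected_Int_frontier) auto
  then obtain t where t: "t \<ge> 0" "c + t *\<^sub>R r \<in> frontier C"
    using frontier_interior_subset by (fastforce simp: g_def)
  have notin: "c + a *\<^sub>R r \<notin> frontier C" if "0 \<le> a" "a < a'" "c + a' *\<^sub>R r \<in> frontier C" for a a'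
  proof -
    have "c + a' *\<^sub>R r - (1 - a / a') *\<^sub>R (c + a' *\<^sub>R r - c) \<in> interior C"
      using that by (intro mem_interior_closure_convex_shrink assms c)
        (auto simp: frontier_def)
    moreover have "c + a' *\<^sub>R r - (1 - a / a') *\<^sub>R (c + a' *\<^sub>R r - c) = c + a *\<^sub>R r"
      using that by (simp add: algebra_simps)
    ultimately have "c + a *\<^sub>R r \<in> interior C"
      by (simp only:)
    then show ?thesis
      by (simp add: frontier_def)
  qed
  have "t > 0"
    using t c by (cases "t = 0") (auto simp: frontier_def)
  have "(THE t. t > 0 \<and> c + t *\<^sub>R r \<in> frontier C) = t"
    using t \<open>t > 0\<close> notin by (intro the_equality) (auto, meson less_imp_le linorder_neqE)
  then have "step_length A b C m = ereal t"
    using leaves by (simp add: step_length_def c_def r_def)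
  then show thesis
    using that t \<open>t > 0\<close> by (simp add: c_def r_def)
qed

lemma ray_in_recession_cone:
  assumes "closed C" "convex C" "j \<notin> finite_steps A b C"
  shows "ray A j \<in> recession_cone C"
proof (rule recession_cone_from_point[OF assms(1,2)])
  show "apex A b + t *\<^sub>R ray A j \<in> C" if "t \<ge> 0" for t
    using assms(3) that interior_subset
    by (fastforce simp: finite_steps_def step_length_def split: if_splits)
qed

lemma admissible_antimono:
  assumes "ray A j \<in> recession_cone C" "admissible A b C j \<gamma>" "\<gamma>' \<le> \<gamma>"
  shows "admissible A b C j \<gamma>'"
  unfolding admissible_def
proof
  fix m assume "m \<in> finite_steps A b C"
  then have "(real_of_ereal (step_length A b C m) *\<^sub>R ray A m - \<gamma> *\<^sub>R ray A j)
      + (\<gamma> - \<gamma>') *\<^sub>R ray A j \<in> recession_cone C"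
    using assms by (intro recession_cone_add recession_cone_scale) (auto simp: admissible_def)
  then show "real_of_ereal (step_length A b C m) *\<^sub>R ray A m - \<gamma>' *\<^sub>R ray A j \<in> recession_cone C"
    by (simp add: algebra_simps)
qed

text \<open>
  Otherwise \<open>0\<close> would be admissible too, making the vector from the apex to a frontier point a
  recession direction, and those lead from interior points to interior points only.
\<close>
lemma admissible_neg:
  assumes "convex C" "apex A b \<in> interior C" "finite_steps A b C \<noteq> {}"
    and "ray A j \<in> recession_cone C" "admissible A b C j \<gamma>"
  shows "\<gamma> < 0"
proof (rule ccontr)
  assume "\<not> \<gamma> < 0"
  then have "admissible A b C j 0"
    using admissible_antimono[OF assms(4,5)] by simp
  moreover obtain m where m: "m \<in> finite_steps A b C"
    using assms(3) by blast
  obtain t where t: "step_length A b C m = ereal t" "apex A b + t *\<^sub>R ray A m \<in> frontier C"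
    using step_length_finite[OF assms(1,2) m] by blast
  ultimately have "t *\<^sub>R ray A m \<in> recession_cone C"
    using m by (force simp: admissible_def)
  then show False
    using interior_plus_recession[OF assms(2)] t(2) by (auto simp: frontier_def)
qed

lemma closed_admissible:
  assumes "closed C"
  shows "closed {\<gamma>. admissible A b C j \<gamma>}"
proof -
  have "closed ((\<lambda>\<gamma>. v - \<gamma> *\<^sub>R ray A j) -` recession_cone C)" for v
    by (intro closed_vimage closed_recession_cone assms continuous_intros)
  moreover have "{\<gamma>. admissible A b C j \<gamma>} = (\<Inter>m\<in>finite_steps A b C.
      (\<lambda>\<gamma>. real_of_ereal (step_length A b C m) *\<^sub>R ray A m - \<gamma> *\<^sub>R ray A j) -` recession_cone C)"
    by (auto simp: admissible_def)
  ultimately show ?thesis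
    by auto
qed

text \<open>
  The admissible values are closed and bounded above by \<open>0\<close>, so their supremum is attained and
  \<open>y_star\<close> is itself admissible unless it is \<open>-\<infinity>\<close>.
\<close>
lemma le_y_star_iff_admissible:
  assumes "closed C" "convex C" "apex A b \<in> interior C" "finite_steps A b C \<noteq> {}"
    and "j \<notin> finite_steps A b C"
  shows "ereal \<gamma> \<le> y_star A b C j \<longleftrightarrow> admissible A b C j \<gamma>"
proof (cases "\<exists>\<gamma>. admissible A b C j \<gamma>")
  case False
  then show ?thesis
    by (simp add: y_star_def)
next
  case True
  define G where "G = {\<gamma>. admissible A b C j \<gamma>}"
  have r: "ray A j \<in> recession_cone C"
    using assms ray_in_recession_cone by blast
  have "\<forall>\<gamma>\<in>G. \<gamma> \<le> 0"
    using admissible_neg[OF assms(2-4) r] by (force simp: G_def)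
  then have bdd: "bdd_above G"
    by (auto simp: bdd_above_def)
  have "Sup G \<in> G"
    using True bdd closed_admissible[OF assms(1)]
    by (intro closed_contains_Sup) (auto simp: G_def)
  moreover have up: "\<gamma> \<le> Sup G" if "admissible A b C j \<gamma>" for \<gamma>
    using that bdd by (intro cSup_upper) (auto simp: G_def)
  ultimately have "(GREATEST \<gamma>. admissible A b C j \<gamma>) = Sup G"
    by (intro Greatest_equality) (auto simp: G_def)
  then have "y_star A b C j = ereal (Sup G)"
    using True by (simp add: y_star_def)
  moreover have "admissible A b C j (Sup G)"
    using \<open>Sup G \<in> G\<close> by (simp add: G_def)
  ultimately show ?thesis
    using up admissible_antimono[OF r] by (metis ereal_less_eq(3))
qed

section \<open>Valid cuts\<close>

theorem theorem10:
  fixes A :: "real^'n^'n" and b :: "real^'n"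
    and S C :: "(real^'n) set" and y :: "'n \<Rightarrow> ereal"
  assumes "invertible A"
    and "closed S"
    and "closed C"
    and "S_free S C"
    and "apex A b \<in> interior C"
    and "finite_steps A b C \<noteq> {}"
    and "\<And>j. j \<notin> finite_steps A b C \<Longrightarrow> y j < 0"
  shows "simplicial_cone A b - interior C \<subseteq> cut_halfspace A b C y \<inter> simplicial_cone A b
    \<longleftrightarrow> (\<forall>j. j \<notin> finite_steps A b C \<longrightarrow> y j \<le> y_star A b C j)"
proof -
  define M where "M = finite_steps A b C"
  define c where "c = apex A b"
  define r where "r = ray A"
  define L where "L m = real_of_ereal (step_length A b C m)" for m
  define \<eta> where "\<eta> j = real_of_ereal (y j)" for j
  define l where "l x i = b $ i - (A *v x) $ i" for x i
  have cvx: "convex C"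
    using assms(4) by (simp add: S_free_def)
  have c: "c \<in> interior C"
    using assms(5) by (simp add: c_def)
  have step: "step_length A b C m = ereal (L m)" "L m > 0" "c + L m *\<^sub>R r m \<in> frontier C"
    if m: "m \<in> M" for m
  proof -
    obtain t where "step_length A b C m = ereal t" "t > 0"
      "apex A b + t *\<^sub>R ray A m \<in> frontier C"
      using step_length_finite[OF cvx assms(5) m[unfolded M_def]] by blast
    then show "step_length A b C m = ereal (L m)" "L m > 0" "c + L m *\<^sub>R r m \<in> frontier C"
      by (simp_all add: L_def c_def r_def)
  qed
  have \<eta>: "\<eta> j \<le> 0" "y j = (if \<eta> j = 0 then -\<infinity> else ereal (\<eta> j))" if "j \<notin> M" for j
    using assms(7)[of j] that by (cases "y j"; auto simp: \<eta>_def M_def)+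
  have r: "r j \<in> recession_cone C" if "j \<notin> M" for j
    using ray_in_recession_cone[OF assms(3) cvx] that by (simp add: M_def r_def)
  have cone: "x \<in> simplicial_cone A b \<longleftrightarrow> (\<forall>i. l x i \<ge> 0)" for x
    by (simp add: simplicial_cone_def l_def)
  have "step_length A b C m \<noteq> 0" if "m \<in> M" for m
    using step[OF that] by simp
  moreover have "y j \<noteq> 0" if "j \<notin> M" for j
    using assms(7)[of j] that by (auto simp: M_def)
  ultimately have cut: "x \<in> cut_halfspace A b C y \<longleftrightarrow>
      (\<Sum>m\<in>M. l x m / L m) + (\<Sum>j\<in>- M. l x j / \<eta> j) \<ge> 1" for x
    using cut_halfspace_iff[of A b C y x] by (simp add: M_def L_def \<eta>_def l_def)
  have bound: "y j \<le> y_star A b C j \<longleftrightarrow>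
      \<eta> j = 0 \<or> (\<forall>m\<in>M. L m *\<^sub>R r m - \<eta> j *\<^sub>R r j \<in> recession_cone C)" if "j \<notin> M" for j
    using \<eta>(2)[OF that] le_y_star_iff_admissible[OF assms(3) cvx assms(5,6), of j "\<eta> j"] that
    by (auto simp: M_def L_def r_def admissible_def)
  show ?thesis
  proof
    assume sub: "simplicial_cone A b - interior C \<subseteq> cut_halfspace A b C y \<inter> simplicial_cone A b"
    show "\<forall>j. j \<notin> finite_steps A b C \<longrightarrow> y j \<le> y_star A b C j"
    proof (intro allI impI, rule ccontr)
      fix j assume "j \<notin> finite_steps A b C" and neg: "\<not> y j \<le> y_star A b C j"
      then have j: "j \<notin> M"
        by (simp add: M_def)
      then obtain m where m: "m \<in> M" "\<eta> j \<noteq> 0"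
        and nrec: "L m *\<^sub>R r m - \<eta> j *\<^sub>R r j \<notin> recession_cone C"
        using bound neg by blast
      define d where "d = L m *\<^sub>R r m - \<eta> j *\<^sub>R r j"
      obtain t where t: "t \<ge> 0" "c + t *\<^sub>R d \<notin> C"
        using recession_cone_from_point[OF assms(3) cvx] nrec unfolding d_def by blast
      define x where "x = c + t *\<^sub>R d"
      have Ax: "A *v x = b - (t * L m) *\<^sub>R axis m 1 + (t * \<eta> j) *\<^sub>R axis j 1"
        by (simp add: x_def d_def c_def r_def matrix_vector_apex[OF assms(1)]
            matrix_vector_ray[OF assms(1)]
            algebra_simps)
      have l: "l x i = (if i = m then t * L m else if i = j then - t * \<eta> j else 0)" for i
        using m j by (auto simp: l_def Ax axis_def)
      have "x \<in> simplicial_cone A b"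
        using t step(2)[OF m(1)] \<eta>(1)[OF j] by (auto simp: cone l mult_nonneg_nonpos)
      moreover have "x \<notin> interior C"
        using t interior_subset by (auto simp: x_def)
      ultimately have "(\<Sum>i\<in>M. l x i / L i) + (\<Sum>i\<in>- M. l x i / \<eta> i) \<ge> 1"
        using sub cut by blast
      moreover have "(\<Sum>i\<in>M. l x i / L i) = (\<Sum>i\<in>M. if i = m then t else 0)"
        using step(2) j by (intro sum.cong) (force simp: l)+
      moreover have "(\<Sum>i\<in>- M. l x i / \<eta> i) = (\<Sum>i\<in>- M. if i = j then - t else 0)"
        using m by (intro sum.cong) (auto simp: l)
      ultimately show False
        using m j by simp
    qed
  next
    assume "\<forall>j. j \<notin> finite_steps A b C \<longrightarrow> y j \<le> y_star A b C j"
    then have adm: "L m *\<^sub>R r m - \<eta> j *\<^sub>R r j \<in> recession_cone C"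
      if "m \<in> M" "j \<notin> M" "\<eta> j \<noteq> 0" for m j
      using that bound by (metis M_def)
    have "x \<in> interior C" if x: "x \<in> simplicial_cone A b" "x \<notin> cut_halfspace A b C y" for x
    proof -
      \<comment> \<open>Rays with \<open>y j = -\<infinity>\<close> have weight \<open>0\<close> in the cut; they only contribute \<open>l x j *\<^sub>R r j\<close>.\<close>
      define J where "J = {j. j \<notin> M \<and> \<eta> j \<noteq> 0}"
      define K where "K = {j. j \<notin> M \<and> \<eta> j = 0}"
      have split: "- M = J \<union> K" "J \<inter> K = {}"
        by (auto simp: J_def K_def)
      have l: "l x i \<ge> 0" for i
        using x cone by blast
      have "c + (\<Sum>m\<in>M. (l x m / L m) *\<^sub>R (L m *\<^sub>R r m)) + (\<Sum>j\<in>J. (l x j / - \<eta> j) *\<^sub>R (- \<eta> j *\<^sub>R r j))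
          \<in> interior C"
      proof (rule cut_shortfall_interior[OF cvx c])
        show "c + L m *\<^sub>R r m \<in> C" if "m \<in> M" for m
          using step(3)[OF that] frontier_subset_closed[OF assms(3)] by blast
        show "- \<eta> j *\<^sub>R r j \<in> recession_cone C" if "j \<in> J" for j
          using that r \<eta>(1) by (intro recession_cone_scale) (auto simp: J_def)
        show "L m *\<^sub>R r m + - \<eta> j *\<^sub>R r j \<in> recession_cone C" if "m \<in> M" "j \<in> J" for m j
          using adm that by (simp add: J_def)
        show "l x m / L m \<ge> 0" if "m \<in> M" for m
          using l step(2)[OF that] by simp
        show "l x j / - \<eta> j \<ge> 0" if "j \<in> J" for j
          using l \<eta>(1)[of j] that by (intro divide_nonneg_nonneg) (auto simp: J_def)
        have "(\<Sum>j\<in>- M. l x j / \<eta> j) = (\<Sum>j\<in>J. l x j / \<eta> j)"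
          by (intro sum.mono_neutral_right) (auto simp: J_def)
        then show "(\<Sum>m\<in>M. l x m / L m) - (\<Sum>j\<in>J. l x j / - \<eta> j) < 1"
          using x(2) by (simp add: cut sum_negf)
      qed simp
      moreover have "(\<Sum>m\<in>M. (l x m / L m) *\<^sub>R (L m *\<^sub>R r m)) = (\<Sum>m\<in>M. l x m *\<^sub>R r m)"
        using step(2) by (intro sum.cong) force+
      moreover have "(\<Sum>j\<in>J. (l x j / - \<eta> j) *\<^sub>R (- \<eta> j *\<^sub>R r j)) = (\<Sum>j\<in>J. l x j *\<^sub>R r j)"
        by (intro sum.cong) (auto simp: J_def)
      moreover have "(\<Sum>j\<in>K. l x j *\<^sub>R r j) \<in> recession_cone C"
        using r l by (intro recession_cone_sum recession_cone_scale) (auto simp: K_def)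
      ultimately have "c + (\<Sum>m\<in>M. l x m *\<^sub>R r m) + (\<Sum>j\<in>J. l x j *\<^sub>R r j) + (\<Sum>j\<in>K. l x j *\<^sub>R r j)
          \<in> interior C"
        by (simp only: interior_plus_recession)
      moreover have "(\<Sum>i\<in>UNIV. l x i *\<^sub>R r i)
          = (\<Sum>m\<in>M. l x m *\<^sub>R r m) + (\<Sum>j\<in>J. l x j *\<^sub>R r j) + (\<Sum>j\<in>K. l x j *\<^sub>R r j)"
      proof -
        have "(\<Sum>i\<in>UNIV. l x i *\<^sub>R r i) = (\<Sum>m\<in>M. l x m *\<^sub>R r m) + (\<Sum>i\<in>- M. l x i *\<^sub>R r i)"
          by (subst sum.union_disjoint[symmetric]) auto
        also have "(\<Sum>i\<in>- M. l x i *\<^sub>R r i) = (\<Sum>j\<in>J. l x j *\<^sub>R r j) + (\<Sum>j\<in>K. l x j *\<^sub>R r j)"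
          unfolding split(1) by (intro sum.union_disjoint split(2)) auto
        finally show ?thesis
          by (simp only: add.assoc)
      qed
      ultimately have "c + (\<Sum>i\<in>UNIV. l x i *\<^sub>R r i) \<in> interior C"
        by (simp add: add.assoc)
      then show ?thesis
        using apex_ray_expansion[OF assms(1), of x b] by (simp add: l_def r_def c_def)
    qed
    then show "simplicial_cone A b - interior C \<subseteq> cut_halfspace A b C y \<inter> simplicial_cone A b"
      by blast
  qed
qed

end
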